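(* Let $(\lambda,\mu,\nu,b,c)$ be a compatible tower. Then $|\nu|\le|\lambda\cap\mu|$.
   Context: $\mathbb{N}^3$ carries the componentwise partial order. A $3$-dimensional Young diagram is a finite subset $\lambda\subseteq\mathbb{N}^3$ such that $w\in\lambda$ and $v\le w$ imply $v\in\lambda$. A tower is a triple $(\lambda,\nu,b)$ where $\lambda$ is a $3$-dimensional Young diagram, $\nu=(\nu_1,\dots,\nu_r)$ with each $\nu_i=\{(0,0,z): z\in\mathbb{N},\ 0\le z<n_i\}$ for some positive integer $n_i$, and $b=(b_1,\dots,b_r)$ with $b_i\in\mathbb{Z}^3$, such that (a) $\nu_1+b_1,\dots,\nu_r+b_r$ are pairwise disjoint and contained in $\lambda$, and (b) for all $w\in\mathbb{N}^3$ and all $v_i\in\nu_i$ with $v_i+b_i+w\in\lambda$ we have $v_i+w\in\nu_i$. A compatible tower is a tuple $(\lambda,\mu,\nu,b,c)$ such that $(\lambda,\nu,b)$ and $(\mu,\nu,c)$ are both towers (same $\nu$). We write $|\nu|=\sum_{i=1}^r|\nu_i|=\sum_i n_i$. *)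

theory Defs
  imports Main
begin

type_synonym pt = "int \<times> int \<times> int"

definition N3 :: "pt set" where
  "N3 = {(x, y, z). 0 \<le> x \<and> 0 \<le> y \<and> 0 \<le> z}"

definition add3 :: "pt \<Rightarrow> pt \<Rightarrow> pt" where
  "add3 v w = (fst v + fst w, fst (snd v) + fst (snd w), snd (snd v) + snd (snd w))"

definition le3 :: "pt \<Rightarrow> pt \<Rightarrow> bool" where
  "le3 v w \<longleftrightarrow> fst v \<le> fst w \<and> fst (snd v) \<le> fst (snd w) \<and> snd (snd v) \<le> snd (snd w)"

definition young3 :: "pt set \<Rightarrow> bool" where
  "young3 L \<longleftrightarrow> finite L \<and> L \<subseteq> N3 \<and>
     (\<forall>w\<in>L. \<forall>v\<in>N3. le3 v w \<longrightarrow> v \<in> L)"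

definition col :: "nat \<Rightarrow> pt set" where
  "col n = {(0, 0, int z) | z. z < n}"

definition shift :: "pt \<Rightarrow> pt set \<Rightarrow> pt set" where
  "shift b S = (\<lambda>v. add3 v b) ` S"

text \<open>Tower (L, nu, b) with nu = (nu_1..nu_r), nu_i = col (n i), b_i = b i, for i < r.\<close>
definition tower :: "pt set \<Rightarrow> nat \<Rightarrow> (nat \<Rightarrow> nat) \<Rightarrow> (nat \<Rightarrow> pt) \<Rightarrow> bool" where
  "tower L r n b \<longleftrightarrow> young3 L \<and> (\<forall>i<r. 0 < n i) \<and>
     (\<forall>i<r. \<forall>j<r. i \<noteq> j \<longrightarrow> shift (b i) (col (n i)) \<inter> shift (b j) (col (n j)) = {}) \<and>
     (\<forall>i<r. shift (b i) (col (n i)) \<subseteq> L) \<and>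
     (\<forall>i<r. \<forall>w\<in>N3. \<forall>v\<in>col (n i). add3 (add3 v (b i)) w \<in> L \<longrightarrow> add3 v w \<in> col (n i))"

definition compatible_tower ::
  "pt set \<Rightarrow> pt set \<Rightarrow> nat \<Rightarrow> (nat \<Rightarrow> nat) \<Rightarrow> (nat \<Rightarrow> pt) \<Rightarrow> (nat \<Rightarrow> pt) \<Rightarrow> bool" where
  "compatible_tower L M r n b c \<longleftrightarrow> tower L r n b \<and> tower M r n c"

end

theory Submission
  imports Defs
begin

text \<open>
  Cut both diagrams into horizontal slices. Element \<open>i\<close> of the tower occupies an interval of
  \<open>n i\<close> heights of \<open>L\<close>, and at each of these heights it sits in a corner of the slice; \<open>c\<close> corners
  in a slice force it to contain the staircase of side \<open>c\<close>. Colour the intervals first-fit from the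
  top, so that intervals of one colour are disjoint and colour \<open>k\<close> is only used where more than
  \<open>k\<close> intervals meet, and call the total length of a colour class its load. If \<open>c\<close> of the loads
  exceed \<open>z\<close>, then the slice at \<open>z\<close> contains the staircase of side \<open>c\<close>; and the slice has at
  least as many cells as there are elements reaching above \<open>z\<close>. Two planar Young diagrams that
  contain staircases of sides \<open>c\<close> and \<open>c'\<close> share at least \<open>c + c' - 1\<close> cells, unless one of them
  is contained in the other. So the slices of \<open>L\<close> and
  \<open>M\<close> at \<open>z\<close> share at least \<open>min \<tau> (min \<tau>' (c + c' - 1))\<close> cells, with \<open>\<tau>\<close>, \<open>\<tau>'\<close> the numbers of
  elements reaching above \<open>z\<close>. The sum of these minima over \<open>z\<close> is at least \<open>\<Sum>i<r. n i\<close> by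
  induction: removing the longest element \<open>i\<close> lowers the minimum at \<open>n i\<close> heights at least.
\<close>

section \<open>Planar Young diagrams\<close>

definition young2 :: "(nat \<times> nat) set \<Rightarrow> bool" where
  "young2 Y \<longleftrightarrow> finite Y \<and> (\<forall>x y x' y'. (x, y) \<in> Y \<longrightarrow> x' \<le> x \<longrightarrow> y' \<le> y \<longrightarrow> (x', y') \<in> Y)"

definition staircase :: "nat \<Rightarrow> (nat \<times> nat) set" where
  "staircase c = {(x, y). x + y < c}"

definition corner :: "(nat \<times> nat) set \<Rightarrow> nat \<times> nat \<Rightarrow> bool" where
  "corner Y p \<longleftrightarrow> p \<in> Y \<and> (Suc (fst p), snd p) \<notin> Y \<and> (fst p, Suc (snd p)) \<notin> Y"

lemma young2_finite: "young2 Y \<Longrightarrow> finite Y"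
  by (simp add: young2_def)

lemma young2_down: "young2 Y \<Longrightarrow> (x, y) \<in> Y \<Longrightarrow> x' \<le> x \<Longrightarrow> y' \<le> y \<Longrightarrow> (x', y') \<in> Y"
  unfolding young2_def by blast

lemma staircase_mono: "c \<le> d \<Longrightarrow> staircase c \<subseteq> staircase d"
  by (auto simp: staircase_def)

text \<open>Two corners never share a coordinate. If \<open>(x, y)\<close> is missing from
  \<open>Y\<close>, every point of \<open>Y\<close> has first coordinate below \<open>x\<close> or
  second below \<open>y\<close>, which leaves room for at most \<open>x + y\<close> corners.\<close>

lemma corners_imp_staircase:
  assumes Y: "young2 Y" and P: "finite P" "\<And>p. p \<in> P \<Longrightarrow> corner Y p"
  shows "staircase (card P) \<subseteq> Y"
proof (rule subrelI, rule ccontr)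
  fix x y assume xy: "(x, y) \<in> staircase (card P)" "(x, y) \<notin> Y"
  have fst_inj: "inj_on fst P"
  proof (rule inj_onI)
    fix p q assume pq: "p \<in> P" "q \<in> P" "fst p = fst q"
    have "\<not> snd p < snd q"
      using P(2)[OF pq(1)] P(2)[OF pq(2)] pq(3) young2_down[OF Y, of "fst q" "snd q" "fst p" "Suc (snd p)"]
      by (cases p; cases q) (auto simp: corner_def)
    moreover have "\<not> snd q < snd p"
      using P(2)[OF pq(1)] P(2)[OF pq(2)] pq(3) young2_down[OF Y, of "fst p" "snd p" "fst q" "Suc (snd q)"]
      by (cases p; cases q) (auto simp: corner_def)
    ultimately show "p = q" using pq(3) by (simp add: prod_eq_iff)
  qed
  have snd_inj: "inj_on snd P"
  proof (rule inj_onI)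
    fix p q assume pq: "p \<in> P" "q \<in> P" "snd p = snd q"
    have "\<not> fst p < fst q"
      using P(2)[OF pq(1)] P(2)[OF pq(2)] pq(3) young2_down[OF Y, of "fst q" "snd q" "Suc (fst p)" "snd p"]
      by (cases p; cases q) (auto simp: corner_def)
    moreover have "\<not> fst q < fst p"
      using P(2)[OF pq(1)] P(2)[OF pq(2)] pq(3) young2_down[OF Y, of "fst p" "snd p" "Suc (fst q)" "snd q"]
      by (cases p; cases q) (auto simp: corner_def)
    ultimately show "p = q" using pq(3) by (simp add: prod_eq_iff)
  qed
  have "P \<subseteq> {p \<in> P. fst p < x} \<union> {p \<in> P. snd p < y}"
  proof
    fix p assume "p \<in> P"
    with P(2) have "(fst p, snd p) \<in> Y" by (simp add: corner_def)
    with xy(2) have "fst p < x \<or> snd p < y" using young2_down[OF Y] not_le by blast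
    with \<open>p \<in> P\<close> show "p \<in> {p \<in> P. fst p < x} \<union> {p \<in> P. snd p < y}" by blast
  qed
  then have "card P \<le> card ({p \<in> P. fst p < x} \<union> {p \<in> P. snd p < y})"
    using P(1) by (intro card_mono) auto
  also have "\<dots> \<le> card {p \<in> P. fst p < x} + card {p \<in> P. snd p < y}"
    by (rule card_Un_le)
  also have "card {p \<in> P. fst p < x} \<le> card {..<x}"
    by (rule card_inj_on_le[where f = fst]) (auto intro: inj_on_subset[OF fst_inj])
  also have "card {p \<in> P. snd p < y} \<le> card {..<y}"
    by (rule card_inj_on_le[where f = snd]) (auto intro: inj_on_subset[OF snd_inj])
  finally show False using xy(1) by (simp add: staircase_def)
qed

lemma young2_meets_diagonals:
  assumes "young2 Y" "(x, y) \<in> Y" "d \<le> x + y"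
  obtains u v where "(u, v) \<in> Y" "u + v = d"
proof (rule that)
  show "(min x d, d - min x d) \<in> Y" using assms by (intro young2_down[OF assms(1,2)]) auto
  show "min x d + (d - min x d) = d" by simp
qed

text \<open>If \<open>Y'\<close> fits into the staircase of side \<open>a\<close>, it lies in
  \<open>Y\<close>. Otherwise it reaches diagonal \<open>a\<close> or beyond, so it has a cell on
  each of the \<open>a\<close> diagonals before that, all inside \<open>Y\<close>. The diagonals
  from \<open>1\<close> to \<open>b - 1\<close> are full in both sets and supply a second cell
  each.\<close>

lemma card_inter_staircases_aux:
  assumes Y: "young2 Y" and Y': "young2 Y'"
    and st: "staircase a \<subseteq> Y" "staircase b \<subseteq> Y'" and ab: "b \<le> a"
  shows "min (card Y') (a + b - 1) \<le> card (Y \<inter> Y')"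
proof (cases "Y' \<subseteq> staircase a")
  case True
  then have "Y \<inter> Y' = Y'" using st by blast
  then show ?thesis by simp
next
  case False
  then obtain x y where xy: "(x, y) \<in> Y'" "a \<le> x + y"
    unfolding staircase_def by (fastforce simp: not_less)
  \<comment> \<open>Pinning the choice to \<open>(d, 0)\<close> for \<open>d < b\<close> keeps
    \<open>(0, d)\<close> free as the second cell. For \<open>d = 0\<close> the two coincide, hence
    \<open>{1..<b}\<close> in \<open>?F\<close>.\<close>
  have "\<exists>p. p \<in> Y' \<and> fst p + snd p = d \<and> (d < b \<longrightarrow> p = (d, 0))" if "d < a" for d
  proof (cases "d < b")
    case True
    then show ?thesis using st(2) by (intro exI[of _ "(d, 0)"]) (auto simp: staircase_def)
  next
    case False
    from young2_meets_diagonals[OF Y' xy(1), of d] xy(2) that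
    obtain u v where "(u, v) \<in> Y'" "u + v = d" by auto
    with False show ?thesis by (intro exI[of _ "(u, v)"]) auto
  qed
  then obtain e where e: "\<And>d. d < a \<Longrightarrow> e d \<in> Y' \<and> fst (e d) + snd (e d) = d \<and> (d < b \<longrightarrow> e d = (d, 0))"
    by metis
  let ?E = "e ` {..<a}" and ?F = "(\<lambda>d. (0, d)) ` {1..<b}"
  have "inj_on e {..<a}"
    by (rule inj_onI) (metis e lessThan_iff)
  then have cE: "card ?E = a" by (simp add: card_image)
  have cF: "card ?F = b - 1" by (simp add: card_image inj_on_def)
  have disj: "?E \<inter> ?F = {}"
  proof (rule ccontr)
    assume "?E \<inter> ?F \<noteq> {}"
    then obtain d d' where "d < a" "1 \<le> d'" "d' < b" "(0, d') = e d" by auto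
    with e[of d] show False by (cases "e d") auto
  qed
  have "?E \<subseteq> staircase a" "?E \<subseteq> Y'" using e by (force simp: staircase_def)+
  moreover have "?F \<subseteq> staircase b" by (auto simp: staircase_def)
  ultimately have "?E \<union> ?F \<subseteq> Y \<inter> Y'"
    using subset_trans[OF _ st(1)] subset_trans[OF _ st(2)] subset_trans[OF _ staircase_mono[OF ab]]
    by (metis Int_subset_iff Un_least)
  then have "card (?E \<union> ?F) \<le> card (Y \<inter> Y')"
    using young2_finite[OF Y] by (intro card_mono) auto
  moreover have "card (?E \<union> ?F) = a + (b - 1)"
    using disj cE cF by (subst card_Un_disjoint) auto
  ultimately show ?thesis by auto
qed

lemma card_inter_staircases:
  assumes "young2 Y" "young2 Y'" "staircase a \<subseteq> Y" "staircase b \<subseteq> Y'"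
  shows "min (card Y) (min (card Y') (a + b - 1)) \<le> card (Y \<inter> Y')"
proof (cases "b \<le> a")
  case True
  from card_inter_staircases_aux[OF assms True] show ?thesis by linarith
next
  case False
  then have "a \<le> b" by simp
  from card_inter_staircases_aux[OF assms(2,1,4,3) this] show ?thesis
    by (auto simp: Int_commute[of Y'] add.commute[of b] min_le_iff_disj)
qed

section \<open>Colouring intervals\<close>

lemma interval_colouring:
  fixes b t :: "'a \<Rightarrow> nat"
  assumes "finite I"
  shows "\<exists>\<kappa> :: 'a \<Rightarrow> nat.
    (\<forall>i\<in>I. \<forall>j\<in>I. i \<noteq> j \<longrightarrow> \<kappa> i = \<kappa> j \<longrightarrow> {b i..<t i} \<inter> {b j..<t j} = {}) \<and>
    (\<forall>i\<in>I. b i < t i \<longrightarrow> \<kappa> i < card {j \<in> I. b j < t i \<and> t i \<le> t j})"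
  using assms
\<comment> \<open>The rule adds an element of largest rank last; the negation makes this the
  interval with the lowest upper end.\<close>
proof (induction I rule: finite_ranking_induct[where f = "\<lambda>i. - int (t i)"])
  case empty
  show ?case by simp
next
  case (insert x S)
  from insert obtain \<kappa> :: "'a \<Rightarrow> nat" where
    dis: "\<And>i j. i \<in> S \<Longrightarrow> j \<in> S \<Longrightarrow> i \<noteq> j \<Longrightarrow> \<kappa> i = \<kappa> j \<Longrightarrow> {b i..<t i} \<inter> {b j..<t j} = {}"
    and col: "\<And>i. i \<in> S \<Longrightarrow> b i < t i \<Longrightarrow> \<kappa> i < card {j \<in> S. b j < t i \<and> t i \<le> t j}"
    by blast
  have fin: "finite S" and top: "\<And>j. j \<in> S \<Longrightarrow> t x \<le> t j" using insert by auto
  show ?case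
  proof (cases "x \<in> S")
    case True
    then show ?thesis using insert by (simp add: insert_absorb)
  next
    case False
    \<comment> \<open>Intervals of \<open>S\<close> outside \<open>A\<close> start at or above
      \<open>t x\<close>, so only the colours of \<open>A\<close> must be avoided. All colours below
      the least free one occur in \<open>A\<close>, which bounds it by
      \<open>card A\<close>.\<close>
    define A where "A = {j \<in> S. b j < t x}"
    have finA: "finite A" using fin by (simp add: A_def)
    define m where "m = (LEAST k. k \<notin> \<kappa> ` A)"
    have "\<exists>k. k \<notin> \<kappa> ` A" using finA ex_new_if_finite infinite_UNIV_nat by blast
    then have m: "m \<notin> \<kappa> ` A" unfolding m_def by (rule LeastI_ex)
    have "{..<m} \<subseteq> \<kappa> ` A" using not_less_Least unfolding m_def by blast
    then have "card {..<m} \<le> card (\<kappa> ` A)" using finA by (intro card_mono) auto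
    also have "\<dots> \<le> card A" by (rule card_image_le[OF finA])
    finally have mA: "m \<le> card A" by simp
    let ?\<kappa> = "\<kappa>(x := m)"
    have new: "{b x..<t x} \<inter> {b j..<t j} = {}" if "j \<in> S" "\<kappa> j = m" for j
    proof -
      from that m have "j \<notin> A" by blast
      with that show ?thesis by (auto simp: A_def)
    qed
    have "{b i..<t i} \<inter> {b j..<t j} = {}"
      if ij: "i \<in> insert x S" "j \<in> insert x S" "i \<noteq> j" "?\<kappa> i = ?\<kappa> j" for i j
    proof -
      consider "i = x" "j \<in> S" "\<kappa> j = m" | "j = x" "i \<in> S" "\<kappa> i = m"
        | "i \<in> S" "j \<in> S" "\<kappa> i = \<kappa> j"
        using ij by (auto split: if_splits)
      then show ?thesis
        using new[of i] new[of j] dis[of i j] ij(3) by cases (simp_all add: Int_commute)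
    qed
    moreover have "?\<kappa> i < card {j \<in> insert x S. b j < t i \<and> t i \<le> t j}"
      if i: "i \<in> insert x S" "b i < t i" for i
    proof (cases "i = x")
      case True
      have "m < card (insert x A)" using mA finA False by (simp add: A_def)
      also have "\<dots> \<le> card {j \<in> insert x S. b j < t x \<and> t x \<le> t j}"
        using fin top i True by (intro card_mono) (auto simp: A_def)
      finally show ?thesis using True by simp
    next
      case False
      with i have "\<kappa> i < card {j \<in> S. b j < t i \<and> t i \<le> t j}" by (intro col) auto
      also have "\<dots> \<le> card {j \<in> insert x S. b j < t i \<and> t i \<le> t j}"
        using fin by (intro card_mono) auto
      finally show ?thesis using False by simp
    qed
    ultimately show ?thesis by blast
  qed
qed

section \<open>Loads of colour classes\<close>

definition load :: "('a \<Rightarrow> nat) \<Rightarrow> ('a \<Rightarrow> nat) \<Rightarrow> 'a set \<Rightarrow> nat \<Rightarrow> nat" where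
  "load \<kappa> n S k = sum n {i \<in> S. \<kappa> i = k}"

text \<open>For finite \<open>S\<close>, the sizes of these sets, as \<open>z\<close> varies, form
  the conjugate of the partition whose parts are the loads.\<close>

definition busy :: "('a \<Rightarrow> nat) \<Rightarrow> ('a \<Rightarrow> nat) \<Rightarrow> 'a set \<Rightarrow> nat \<Rightarrow> nat set" where
  "busy \<kappa> n S z = {k. z < load \<kappa> n S k}"

lemma load_mono: "finite S \<Longrightarrow> R \<subseteq> S \<Longrightarrow> load \<kappa> n R k \<le> load \<kappa> n S k"
  unfolding load_def by (rule sum_mono2) auto

lemma load_le_sum: "finite S \<Longrightarrow> load \<kappa> n S k \<le> sum n S"
  unfolding load_def by (rule sum_mono2) auto

lemma load_remove:
  assumes "finite S" "i \<in> S"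
  shows "load \<kappa> n S k = load \<kappa> n (S - {i}) k + (if \<kappa> i = k then n i else 0)"
proof (cases "\<kappa> i = k")
  case True
  have "{j \<in> S. \<kappa> j = k} = insert i {j \<in> S - {i}. \<kappa> j = k}" using assms True by auto
  with True assms show ?thesis by (simp add: load_def)
next
  case False
  then have "{j \<in> S. \<kappa> j = k} = {j \<in> S - {i}. \<kappa> j = k}" by auto
  with False show ?thesis by (simp add: load_def)
qed

lemma load_insert:
  assumes "finite S" "i \<notin> S"
  shows "load \<kappa> n (insert i S) k = load \<kappa> n S k + (if \<kappa> i = k then n i else 0)"
  using load_remove[of "insert i S" i \<kappa> n k] assms by simp

lemma finite_busy: assumes "finite S" shows "finite (busy \<kappa> n S z)"
proof (rule finite_subset)
  show "busy \<kappa> n S z \<subseteq> \<kappa> ` S"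
  proof
    fix k assume "k \<in> busy \<kappa> n S z"
    then have "load \<kappa> n S k \<noteq> 0" by (simp add: busy_def)
    then have "{i \<in> S. \<kappa> i = k} \<noteq> {}" unfolding load_def using sum.empty by metis
    then show "k \<in> \<kappa> ` S" by blast
  qed
qed (use assms in simp)

lemma busy_mono: "finite S \<Longrightarrow> R \<subseteq> S \<Longrightarrow> busy \<kappa> n R z \<subseteq> busy \<kappa> n S z"
  unfolding busy_def using load_mono less_le_trans by blast

text \<open>
  Here \<open>Q\<close> plays the role of the set of elements lying entirely below height \<open>z\<close>. If the class of
  \<open>i\<close> does not fit below \<open>z\<close>, some member \<open>j\<close> of it is outside \<open>Q\<close> and can take the place of \<open>i\<close>,
  since \<open>i\<close> is heaviest.
\<close>

lemma remove_heaviest: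
  assumes fin: "finite I" and i: "i \<in> I" and max: "\<And>j. j \<in> I \<Longrightarrow> n j \<le> n i"
    and Q: "Q \<subseteq> I" "\<And>k. load \<kappa> n Q k \<le> z"
  shows "\<exists>R \<subseteq> I - {i}. (\<forall>k. load \<kappa> n R k \<le> z) \<and>
    card (I - {i} - R) + (if z < load \<kappa> n I (\<kappa> i) then 1 else 0) \<le> card (I - Q)"
\<comment> \<open>Outside this case \<open>Q - {i}\<close> will do: either \<open>i\<close> itself
  is counted in \<open>I - Q\<close>, and its removal lowers the count, or no drop is
  demanded.\<close>
proof (cases "i \<in> Q \<and> z < load \<kappa> n I (\<kappa> i)")
  case False
  have finQ: "finite Q" using fin Q(1) finite_subset by blast
  have "load \<kappa> n (Q - {i}) k \<le> z" for k
    using load_mono[OF finQ, of "Q - {i}" \<kappa> n k] Q(2)[of k] by auto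
  moreover have "card (I - {i} - (Q - {i})) + (if z < load \<kappa> n I (\<kappa> i) then 1 else 0) \<le> card (I - Q)"
  proof (cases "i \<in> Q")
    case True
    then have "I - {i} - (Q - {i}) = I - Q" by blast
    with True False show ?thesis by simp
  next
    case notin: False
    then have "I - Q = insert i (I - {i} - (Q - {i}))" using i by blast
    then have "card (I - Q) = Suc (card (I - {i} - (Q - {i})))" using fin by simp
    then show ?thesis by simp
  qed
  ultimately show ?thesis using Q(1) by (intro exI[of _ "Q - {i}"]) auto
next
  case True
  have finQ: "finite Q" using fin Q(1) finite_subset by blast
  have "\<exists>j \<in> I - Q. \<kappa> j = \<kappa> i"
  proof (rule ccontr)
    assume "\<not> ?thesis"
    then have "{j \<in> I. \<kappa> j = \<kappa> i} = {j \<in> Q. \<kappa> j = \<kappa> i}" using Q(1) by blast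
    then have "load \<kappa> n I (\<kappa> i) = load \<kappa> n Q (\<kappa> i)" by (simp add: load_def)
    with True Q(2)[of "\<kappa> i"] show False by simp
  qed
  then obtain j where j: "j \<in> I" "j \<notin> Q" "\<kappa> j = \<kappa> i" by blast
  with True have ji: "j \<noteq> i" by blast
  let ?R = "insert j (Q - {i})"
  have "load \<kappa> n ?R k \<le> load \<kappa> n Q k" for k
    using load_insert[of "Q - {i}" j \<kappa> n k] load_remove[of Q i \<kappa> n k] True finQ j max[OF j(1)]
    by auto
  then have "\<forall>k. load \<kappa> n ?R k \<le> z" using Q(2) order_trans by blast
  moreover have "I - Q = insert j (I - {i} - ?R)" using j True by blast
  then have "card (I - Q) = Suc (card (I - {i} - ?R))" using fin by simp
  ultimately show ?thesis using Q(1) j ji by (intro exI[of _ ?R]) auto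
qed

text \<open>Without \<open>i\<close> the load of its class falls from above \<open>z\<close> to at
  most \<open>z\<close>, so this colour leaves the busy set and no other enters.\<close>

lemma busy_remove_less:
  assumes "finite I" "i \<in> I" "load \<kappa> n I (\<kappa> i) \<le> z + n i" "z < load \<kappa> n I (\<kappa> i)"
  shows "card (busy \<kappa> n (I - {i}) z) < card (busy \<kappa> n I z)"
proof (rule psubset_card_mono)
  have "\<kappa> i \<in> busy \<kappa> n I z - busy \<kappa> n (I - {i}) z"
    using assms load_remove[OF assms(1,2), of \<kappa> n "\<kappa> i"] by (auto simp: busy_def)
  moreover have "busy \<kappa> n (I - {i}) z \<subseteq> busy \<kappa> n I z"
    using assms(1) by (intro busy_mono) auto
  ultimately show "busy \<kappa> n (I - {i}) z \<subset> busy \<kappa> n I z" by blast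
qed (rule finite_busy[OF assms(1)])

text \<open>The sets \<open>Q z\<close> are bound only by their loads: the exchange in
  \<open>remove_heaviest\<close> preserves this bound, but need not preserve the property of lying
  below height \<open>z\<close>.\<close>

lemma sum_le_two_colourings:
  fixes n :: "'a \<Rightarrow> nat"
  assumes "finite I" "sum n I \<le> Z"
    and "\<And>z. Q z \<subseteq> I" "\<And>z k. load \<kappa> n (Q z) k \<le> z"
    and "\<And>z. Q' z \<subseteq> I" "\<And>z k. load \<kappa>' n (Q' z) k \<le> z"
  shows "sum n I \<le> (\<Sum>z<Z. min (card (I - Q z)) (min (card (I - Q' z))
    (card (busy \<kappa> n I z) + card (busy \<kappa>' n I z) - 1)))"
  using assms
proof (induction I arbitrary: Q Q' rule: finite_psubset_induct)
  case (psubset I)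
  show ?case
  proof (cases "I = {}")
    case True
    then show ?thesis by simp
  next
    case False
    note fin = \<open>finite I\<close>
    have "Max (n ` I) \<in> n ` I" using fin False by simp
    then obtain i where i: "i \<in> I" "n i = Max (n ` I)" by auto
    then have max: "\<And>j. j \<in> I \<Longrightarrow> n j \<le> n i" using fin by simp
    let ?I = "I - {i}"
    have "\<exists>R \<subseteq> ?I. (\<forall>k. load \<kappa> n R k \<le> z) \<and>
        card (?I - R) + (if z < load \<kappa> n I (\<kappa> i) then 1 else 0) \<le> card (I - Q z)" for z
      by (rule remove_heaviest[OF fin i(1)]) (use psubset.prems max in auto)
    then obtain R where R: "\<And>z. R z \<subseteq> ?I" "\<And>z k. load \<kappa> n (R z) k \<le> z"
      "\<And>z. card (?I - R z) + (if z < load \<kappa> n I (\<kappa> i) then 1 else 0) \<le> card (I - Q z)"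
      by metis
    have "\<exists>R \<subseteq> ?I. (\<forall>k. load \<kappa>' n R k \<le> z) \<and>
        card (?I - R) + (if z < load \<kappa>' n I (\<kappa>' i) then 1 else 0) \<le> card (I - Q' z)" for z
      by (rule remove_heaviest[OF fin i(1)]) (use psubset.prems max in auto)
    then obtain R' where R': "\<And>z. R' z \<subseteq> ?I" "\<And>z k. load \<kappa>' n (R' z) k \<le> z"
      "\<And>z. card (?I - R' z) + (if z < load \<kappa>' n I (\<kappa>' i) then 1 else 0) \<le> card (I - Q' z)"
      by metis
    define s where "s z = min (card (I - Q z)) (min (card (I - Q' z))
      (card (busy \<kappa> n I z) + card (busy \<kappa>' n I z) - 1))" for z
    define s' where "s' z = min (card (?I - R z)) (min (card (?I - R' z))
      (card (busy \<kappa> n ?I z) + card (busy \<kappa>' n ?I z) - 1))" for z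
    have sum_I: "sum n I = sum n ?I + n i" using fin i(1) by (simp add: sum.remove)
    have IH: "sum n ?I \<le> (\<Sum>z<Z. s' z)"
      unfolding s'_def using i(1) sum_I psubset.prems(1) R R' by (intro psubset.IH) auto
    \<comment> \<open>On the window of length \<open>n i\<close> just below \<open>h\<close>, both
      classes of \<open>i\<close> have load above \<open>z\<close>, so both counts of outside
      elements drop. The class whose load is \<open>h\<close> stops being busy there, so the third
      term drops too.\<close>
    define h where "h = min (load \<kappa> n I (\<kappa> i)) (load \<kappa>' n I (\<kappa>' i))"
    have h: "n i \<le> h" "h \<le> Z"
      using load_remove[OF fin i(1), of \<kappa> n "\<kappa> i"] load_remove[OF fin i(1), of \<kappa>' n "\<kappa>' i"]
        load_le_sum[OF fin, of \<kappa> n "\<kappa> i"] psubset.prems(1) by (auto simp: h_def)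
    have step: "s' z + (if z \<in> {h - n i..<h} then 1 else 0) \<le> s z" for z
    proof -
      have le: "card (busy \<kappa> n ?I z) \<le> card (busy \<kappa> n I z)"
        "card (busy \<kappa>' n ?I z) \<le> card (busy \<kappa>' n I z)"
        using fin by (intro card_mono finite_busy busy_mono; simp)+
      show ?thesis
      proof (cases "z \<in> {h - n i..<h}")
        case False
        then show ?thesis using R(3)[of z] R'(3)[of z] le unfolding s_def s'_def
          by (auto simp: min_def split: if_splits)
      next
        case True
        then have "h \<le> z + n i" by auto
        from True have z: "z < load \<kappa> n I (\<kappa> i)" "z < load \<kappa>' n I (\<kappa>' i)" by (auto simp: h_def)
        have "\<kappa> i \<in> busy \<kappa> n I z" "\<kappa>' i \<in> busy \<kappa>' n I z" using z by (auto simp: busy_def)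
        \<comment> \<open>With both counts positive, their sum is at least 2, so the truncated
          \<open>- 1\<close> cannot hide the drop even if no colour stays busy.\<close>
        then have pos: "0 < card (busy \<kappa> n I z)" "0 < card (busy \<kappa>' n I z)"
          using finite_busy[OF fin] card_gt_0_iff by blast+
        have "card (busy \<kappa> n ?I z) < card (busy \<kappa> n I z) \<or>
            card (busy \<kappa>' n ?I z) < card (busy \<kappa>' n I z)"
          using busy_remove_less[OF fin i(1) _ z(1)] busy_remove_less[OF fin i(1) _ z(2)] \<open>h \<le> z + n i\<close>
          by (auto simp: h_def min_le_iff_disj)
        with le pos have "card (busy \<kappa> n ?I z) + card (busy \<kappa>' n ?I z) - 1 + 1
            \<le> card (busy \<kappa> n I z) + card (busy \<kappa>' n I z) - 1" by linarith
        then show ?thesis using R(3)[of z] R'(3)[of z] z True unfolding s_def s'_def by auto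
      qed
    qed
    have "{..<Z} \<inter> {h - n i..<h} = {h - n i..<h}" using h by auto
    then have "(\<Sum>z<Z. if z \<in> {h - n i..<h} then 1 else 0) = n i"
      using h(1) sum.inter_restrict[of "{..<Z}" "\<lambda>_. 1 :: nat" "{h - n i..<h}"] by simp
    then have "sum n I \<le> (\<Sum>z<Z. s' z + (if z \<in> {h - n i..<h} then 1 else 0))"
      using IH sum_I by (simp add: sum.distrib)
    also have "\<dots> \<le> (\<Sum>z<Z. s z)" by (rule sum_mono) (rule step)
    finally show ?thesis unfolding s_def .
  qed
qed

section \<open>Slices of a tower\<close>

definition slice :: "pt set \<Rightarrow> nat \<Rightarrow> (nat \<times> nat) set" where
  "slice L z = {(x, y). (int x, int y, int z) \<in> L}"

lemma young3_down:
  assumes "young3 L" "(int x, int y, int z) \<in> L" "x' \<le> x" "y' \<le> y" "z' \<le> z"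
  shows "(int x', int y', int z') \<in> L"
proof -
  have "(int x', int y', int z') \<in> N3" by (simp add: N3_def)
  moreover have "le3 (int x', int y', int z') (int x, int y, int z)"
    using assms by (simp add: le3_def)
  ultimately show ?thesis using assms(1,2) unfolding young3_def by blast
qed

lemma young2_slice:
  assumes "young3 L" shows "young2 (slice L z)"
proof -
  have "(\<lambda>(x, y). (int x, int y, int z)) ` slice L z \<subseteq> L" by (auto simp: slice_def)
  moreover have "finite L" using assms by (simp add: young3_def)
  moreover have "inj_on (\<lambda>(x, y). (int x, int y, int z)) (slice L z)" by (auto simp: inj_on_def)
  ultimately have "finite (slice L z)" using finite_subset finite_imageD by metis
  moreover have "(x', y') \<in> slice L z" if "(x, y) \<in> slice L z" "x' \<le> x" "y' \<le> y" for x y x' y'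
    using young3_down[OF assms _ that(2,3), of z z] that(1) by (simp add: slice_def)
  ultimately show ?thesis unfolding young2_def by blast
qed

lemma slice_antimono: "young3 L \<Longrightarrow> z \<le> z' \<Longrightarrow> slice L z' \<subseteq> slice L z"
  using young3_down by (fastforce simp: slice_def)

lemma sum_card_slices_le:
  assumes "finite L"
  shows "(\<Sum>z<Z. card (slice L z)) \<le> card L"
proof -
  define f where "f z = (\<lambda>(x, y). (int x, int y, int z)) ` slice L z" for z
  have sub: "f z \<subseteq> L" for z by (auto simp: slice_def f_def)
  have "card (slice L z) = card (f z)" for z
    unfolding f_def by (rule card_image[symmetric]) (auto simp: inj_on_def)
  then have "(\<Sum>z<Z. card (slice L z)) = (\<Sum>z<Z. card (f z))" by simp
  also have "\<dots> = card (\<Union>z<Z. f z)"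
  proof (rule card_UN_disjoint[symmetric])
    show "\<forall>z\<in>{..<Z}. finite (f z)" using finite_subset[OF sub assms] by blast
  qed (auto simp: f_def)
  also have "\<dots> \<le> card L" using sub assms by (intro card_mono) auto
  finally show ?thesis .
qed

text \<open>Column \<open>i\<close> stands over the cell \<open>p i\<close> and fills the heights
  from \<open>h i\<close> to \<open>h i + n i - 1\<close>. A cell of \<open>L\<close> next to it, in
  the outward direction, would be a translate that condition (b) forces back into the column; this
  gives the corners.\<close>

lemma tower_coords:
  assumes "tower L r n b"
  obtains p :: "nat \<Rightarrow> nat \<times> nat" and h :: "nat \<Rightarrow> nat"
  where "\<And>i z. i < r \<Longrightarrow> z < h i + n i \<Longrightarrow> p i \<in> slice L z"
    and "\<And>i z. i < r \<Longrightarrow> h i \<le> z \<Longrightarrow> z < h i + n i \<Longrightarrow> corner (slice L z) (p i)"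
    and "inj_on p {..<r}"
proof -
  have young: "young3 L" and pos: "\<And>i. i < r \<Longrightarrow> 0 < n i"
    and disj: "\<And>i j. i < r \<Longrightarrow> j < r \<Longrightarrow> i \<noteq> j \<Longrightarrow>
      shift (b i) (col (n i)) \<inter> shift (b j) (col (n j)) = {}"
    and sub: "\<And>i. i < r \<Longrightarrow> shift (b i) (col (n i)) \<subseteq> L"
    and closed: "\<And>i w v. i < r \<Longrightarrow> w \<in> N3 \<Longrightarrow> v \<in> col (n i) \<Longrightarrow>
      add3 (add3 v (b i)) w \<in> L \<Longrightarrow> add3 v w \<in> col (n i)"
    using assms unfolding tower_def by blast+
  define p where "p i = (nat (fst (b i)), nat (fst (snd (b i))))" for i
  define h where "h i = nat (snd (snd (b i)))" for i
  \<comment> \<open>The lowest cell of the column is \<open>b i\<close> itself, which lies in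
    \<open>L\<close> and hence in \<open>N3\<close>, so \<open>nat\<close> loses nothing.\<close>
  have b_eq: "b i = (int (fst (p i)), int (snd (p i)), int (h i))" if "i < r" for i
  proof -
    have "add3 (0, 0, int 0) (b i) \<in> shift (b i) (col (n i))"
      unfolding shift_def using pos[OF that] by (intro imageI) (force simp: col_def)
    then have "b i \<in> L" using sub[OF that] by (auto simp: add3_def)
    then have "b i \<in> N3" using young by (auto simp: young3_def)
    then show ?thesis by (auto simp: N3_def p_def h_def prod_eq_iff split: prod.splits)
  qed
  have shift_eq: "shift (b i) (col (n i)) =
      {(int (fst (p i)), int (snd (p i)), int (h i + z)) | z. z < n i}" if "i < r" for i
    unfolding shift_def col_def b_eq[OF that] by (auto simp: add3_def image_iff)
  have top: "(int (fst (p i)), int (snd (p i)), int (h i + (n i - 1))) \<in> shift (b i) (col (n i))"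
    if "i < r" for i
    unfolding shift_eq[OF that] using pos[OF that] by (intro CollectI exI[of _ "n i - 1"]) simp
  have mem: "(int (fst (p i)), int (snd (p i)), int z) \<in> L" if "i < r" "z < h i + n i" for i z
  proof -
    have "(int (fst (p i)), int (snd (p i)), int (h i + (n i - 1))) \<in> L"
      using sub[OF that(1)] top[OF that(1)] by blast
    from young3_down[OF young this, of "fst (p i)" "snd (p i)" z] that(2) pos[OF that(1)]
    show ?thesis by auto
  qed
  have above: "(int (fst (p i)), int (snd (p i)), int (h i + n i)) \<notin> L" if "i < r" for i
  proof
    assume "(int (fst (p i)), int (snd (p i)), int (h i + n i)) \<in> L"
    then have "add3 (add3 (0, 0, int (n i - 1)) (b i)) (0, 0, 1) \<in> L"
      using pos[OF that] b_eq[OF that] by (simp add: add3_def of_nat_diff add.commute)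
    moreover have "(0, 0, int (n i - 1)) \<in> col (n i)"
      using pos[OF that] unfolding col_def by (intro CollectI exI[of _ "n i - 1"]) auto
    ultimately have "add3 (0, 0, int (n i - 1)) (0, 0, 1) \<in> col (n i)"
      using closed[OF that, of "(0, 0, 1)"] by (simp add: N3_def)
    then show False using pos[OF that] by (auto simp: add3_def col_def)
  qed
  have beside: "(int (fst (p i)) + u, int (snd (p i)) + v, int z) \<notin> L"
    if "i < r" "h i \<le> z" "z < h i + n i" "0 \<le> u" "0 \<le> v" "u + v \<noteq> 0" for i z u v
  proof
    assume "(int (fst (p i)) + u, int (snd (p i)) + v, int z) \<in> L"
    then have "add3 (add3 (0, 0, int (z - h i)) (b i)) (u, v, 0) \<in> L"
      using that b_eq[OF that(1)] by (simp add: add3_def of_nat_diff algebra_simps)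
    moreover have "(0, 0, int (z - h i)) \<in> col (n i)"
      using that(2,3) unfolding col_def by (intro CollectI exI[of _ "z - h i"]) auto
    ultimately have "add3 (0, 0, int (z - h i)) (u, v, 0) \<in> col (n i)"
      using closed[OF that(1), of "(u, v, 0)"] that by (simp add: N3_def)
    then show False using that by (auto simp: add3_def col_def)
  qed
  show ?thesis
  proof (rule that[of h p])
    show "p i \<in> slice L z" if "i < r" "z < h i + n i" for i z
      using mem[OF that] by (auto simp: slice_def split: prod.splits)
    then show "corner (slice L z) (p i)" if "i < r" "h i \<le> z" "z < h i + n i" for i z
      using that beside[OF that, of 1 0] beside[OF that, of 0 1]
      by (auto simp: corner_def slice_def add.commute)
    show "inj_on p {..<r}"
    proof (rule inj_onI, rule ccontr)
      \<comment> \<open>By \<open>mem\<close> and \<open>above\<close>, the cells of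
        \<open>L\<close> over \<open>p i\<close> end exactly at the top of column \<open>i\<close>.
        Two columns over one cell would therefore share their top cell.\<close>
      fix i j assume ij: "i \<in> {..<r}" "j \<in> {..<r}" "p i = p j" "i \<noteq> j"
      have "\<not> h i + n i < h j + n j" using above[of i] mem[of j "h i + n i"] ij by auto
      moreover have "\<not> h j + n j < h i + n i" using above[of j] mem[of i "h j + n j"] ij by auto
      ultimately have eq: "h i + n i = h j + n j" by simp
      then have "h i + (n i - 1) = h j + (n j - 1)" using pos[of i] pos[of j] ij by auto
      then show False using top[of i] top[of j] disj[of i j] ij by auto
    qed
  qed
qed

text \<open>This provides what \<open>sum_le_two_colourings\<close> asks of one colouring, with
  bounds that tie its terms to the slices of \<open>L\<close>. The set \<open>Q z\<close> consists
  of the columns that end at or below \<open>z\<close>.\<close>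

lemma tower_colouring:
  assumes "tower L r n b"
  obtains \<kappa> :: "nat \<Rightarrow> nat" and Q :: "nat \<Rightarrow> nat set"
  where "\<And>z. Q z \<subseteq> {..<r}" "\<And>z k. load \<kappa> n (Q z) k \<le> z"
    and "\<And>z. card ({..<r} - Q z) \<le> card (slice L z)"
    and "\<And>z. staircase (card (busy \<kappa> n {..<r} z)) \<subseteq> slice L z"
proof -
  have young: "young3 L" and pos: "\<And>i. i < r \<Longrightarrow> 0 < n i"
    using assms unfolding tower_def by blast+
  obtain p :: "nat \<Rightarrow> nat \<times> nat" and h :: "nat \<Rightarrow> nat"
    where mem: "\<And>i z. i < r \<Longrightarrow> z < h i + n i \<Longrightarrow> p i \<in> slice L z"
      and corner: "\<And>i z. i < r \<Longrightarrow> h i \<le> z \<Longrightarrow> z < h i + n i \<Longrightarrow> corner (slice L z) (p i)"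
      and inj: "inj_on p {..<r}"
    using tower_coords[OF assms] by metis
  define t where "t i = h i + n i" for i
  obtain \<kappa> :: "nat \<Rightarrow> nat" where
    dis: "\<forall>i\<in>{..<r}. \<forall>j\<in>{..<r}. i \<noteq> j \<longrightarrow> \<kappa> i = \<kappa> j \<longrightarrow> {h i..<t i} \<inter> {h j..<t j} = {}"
    and "\<forall>i\<in>{..<r}. h i < t i \<longrightarrow> \<kappa> i < card {j \<in> {..<r}. h j < t i \<and> t i \<le> t j}"
    using interval_colouring[of "{..<r}" h t] by blast
  then have col: "\<kappa> i < card {j \<in> {..<r}. h j < t i \<and> t i \<le> t j}" if "i < r" for i
    using that pos[OF that] by (simp add: t_def)
  define Q where "Q z = {i \<in> {..<r}. t i \<le> z}" for z
  have load: "load \<kappa> n (Q z) k \<le> z" for z k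
  proof -
    let ?C = "{i \<in> Q z. \<kappa> i = k}"
    have "load \<kappa> n (Q z) k = (\<Sum>i\<in>?C. card {h i..<t i})" by (simp add: load_def t_def)
    also have "\<dots> = card (\<Union>i\<in>?C. {h i..<t i})"
    proof (rule card_UN_disjoint[symmetric])
      show "\<forall>i\<in>?C. \<forall>j\<in>?C. i \<noteq> j \<longrightarrow> {h i..<t i} \<inter> {h j..<t j} = {}"
        using dis unfolding Q_def by blast
    qed (simp_all add: Q_def)
    also have "\<dots> \<le> card {..<z}" by (intro card_mono) (auto simp: Q_def)
    finally show ?thesis by simp
  qed
  have stair: "staircase (card (busy \<kappa> n {..<r} z)) \<subseteq> slice L z" for z
  proof (cases "busy \<kappa> n {..<r} z = {}")
    case True
    then show ?thesis by (simp add: staircase_def)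
  next
    case False
    let ?K = "busy \<kappa> n {..<r} z"
    have fin: "finite ?K" by (rule finite_busy) simp
    \<comment> \<open>There are at most \<open>Max ?K + 1\<close> busy colours, so it suffices to
      find that many corners at some height not below \<open>z\<close>.\<close>
    with False have "Max ?K \<in> ?K" by simp
    then have "z < load \<kappa> n {..<r} (Max ?K)" by (simp add: busy_def)
    \<comment> \<open>The members of a class that end by height \<open>z\<close> have total length
      at most \<open>z\<close>, so a busy class has one that reaches higher.\<close>
    have "\<exists>i<r. \<kappa> i = Max ?K \<and> z < t i"
    proof (rule ccontr)
      assume "\<not> ?thesis"
      then have "{i \<in> {..<r}. \<kappa> i = Max ?K} = {i \<in> Q z. \<kappa> i = Max ?K}"
        unfolding Q_def using not_le by blast
      then have "load \<kappa> n {..<r} (Max ?K) = load \<kappa> n (Q z) (Max ?K)" by (simp add: load_def)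
      with \<open>z < load \<kappa> n {..<r} (Max ?K)\<close> load[of z "Max ?K"] show False by simp
    qed
    then obtain i where i: "i < r" "\<kappa> i = Max ?K" "z < t i" by blast
    \<comment> \<open>All these columns pass through height \<open>t i - 1\<close>, and the
      colouring guarantees more than \<open>\<kappa> i\<close> of them.\<close>
    let ?J = "{j \<in> {..<r}. h j < t i \<and> t i \<le> t j}"
    have "card ?K \<le> card {..Max ?K}" using fin by (intro card_mono) auto
    also have "\<dots> \<le> card ?J" using col[OF i(1)] i(2) by simp
    also have "\<dots> = card (p ` ?J)"
      by (rule card_image[symmetric]) (rule inj_on_subset[OF inj], auto)
    finally have "staircase (card ?K) \<subseteq> staircase (card (p ` ?J))" by (rule staircase_mono)
    also have "\<dots> \<subseteq> slice L (t i - 1)"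
    proof (rule corners_imp_staircase[OF young2_slice[OF young]])
      show "corner (slice L (t i - 1)) q" if "q \<in> p ` ?J" for q
      proof -
        from that obtain j where "j < r" "h j < t i" "t i \<le> t j" "q = p j" by blast
        then show ?thesis using corner[of j "t i - 1"] i(3) by (simp add: t_def)
      qed
    qed simp
    also have "\<dots> \<subseteq> slice L z" using i(3) by (intro slice_antimono young) simp
    finally show ?thesis .
  qed
  show ?thesis
  proof (rule that[of Q \<kappa>])
    show "card ({..<r} - Q z) \<le> card (slice L z)" for z
    proof (rule card_inj_on_le[where f = p])
      show "inj_on p ({..<r} - Q z)" using inj by (rule inj_on_subset) auto
      show "p ` ({..<r} - Q z) \<subseteq> slice L z"
        unfolding Q_def t_def by (intro image_subsetI mem) auto
      show "finite (slice L z)" by (rule young2_finite[OF young2_slice[OF young]])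
    qed
  qed (use load stair in \<open>auto simp: Q_def\<close>)
qed

section \<open>Summation of the slice estimates\<close>

theorem theorem2p1:
  assumes "compatible_tower L M r n b c"
  shows "(\<Sum>i<r. n i) \<le> card (L \<inter> M)"
proof -
  have L: "tower L r n b" and M: "tower M r n c"
    using assms by (auto simp: compatible_tower_def)
  then have yL: "young3 L" and yM: "young3 M" by (auto simp: tower_def)
  obtain \<kappa> Q where Q: "\<And>z. Q z \<subseteq> {..<r}" "\<And>z k. load \<kappa> n (Q z) k \<le> z"
    and cL: "\<And>z. card ({..<r} - Q z) \<le> card (slice L z)"
    and sL: "\<And>z. staircase (card (busy \<kappa> n {..<r} z)) \<subseteq> slice L z"
    using tower_colouring[OF L] by metis
  obtain \<kappa>' Q' where Q': "\<And>z. Q' z \<subseteq> {..<r}" "\<And>z k. load \<kappa>' n (Q' z) k \<le> z"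
    and cM: "\<And>z. card ({..<r} - Q' z) \<le> card (slice M z)"
    and sM: "\<And>z. staircase (card (busy \<kappa>' n {..<r} z)) \<subseteq> slice M z"
    using tower_colouring[OF M] by metis
  \<comment> \<open>This many heights suffice for the induction; common cells in higher slices are
    simply not counted.\<close>
  let ?Z = "\<Sum>i<r. n i"
  have "(\<Sum>i<r. n i) \<le> (\<Sum>z<?Z. min (card ({..<r} - Q z)) (min (card ({..<r} - Q' z))
      (card (busy \<kappa> n {..<r} z) + card (busy \<kappa>' n {..<r} z) - 1)))"
    using Q Q' by (intro sum_le_two_colourings) auto
  also have "\<dots> \<le> (\<Sum>z<?Z. card (slice (L \<inter> M) z))"
  proof (rule sum_mono)
    fix z
    have "slice (L \<inter> M) z = slice L z \<inter> slice M z" by (auto simp: slice_def)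
    with card_inter_staircases[OF young2_slice[OF yL] young2_slice[OF yM] sL[of z] sM[of z]]
    show "min (card ({..<r} - Q z)) (min (card ({..<r} - Q' z))
      (card (busy \<kappa> n {..<r} z) + card (busy \<kappa>' n {..<r} z) - 1)) \<le> card (slice (L \<inter> M) z)"
      using cL[of z] cM[of z] by (auto simp: min_le_iff_disj)
  qed
  also have "\<dots> \<le> card (L \<inter> M)" using yL by (intro sum_card_slices_le) (simp add: young3_def)
  finally show ?thesis .
qed

end
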